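(* $c(C_5,B)=c_1(C_5,B)=1/16$, where $C_5$ is the cycle of length 5 and $B$ is the banner graph.
   Context: The banner graph $B$ is obtained from the 4-cycle $C_4$ by adding a pendant edge (a new vertex joined to one vertex of the cycle). For graphs $H,G$, $t(H,G)=\hom(H,G)/v(G)^{v(H)}$ is the probability that a uniformly random map $V(H)\to V(G)$ is a homomorphism. Let $G_1,G_2,\dots$ be a sequence containing every finite graph exactly once; $\overline{G}$ is the complement of $G$. For $\lambda\in[0,2]$, $c_\lambda(H_1,H_2):=\liminf_{n\to\infty}\left[\lambda\, t(H_1,G_n)+(2-\lambda)\, t(H_2,\overline{G_n})\right]$, and $c(H_1,H_2):=\sup_{\lambda\in[0,2]}c_\lambda(H_1,H_2)$. *)

theory Defs
  imports
    "HOL-Analysis.Analysis"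
    "Graph_Theory.Pair_Digraph"
    "Graph_Theory.Digraph_Isomorphism"
begin

text \<open>
  A finite simple graph is a symmetric, loop-free, finite digraph without parallel arcs
  (locale \<open>pair_graph\<close>), each edge being represented by its two arcs. The vertex set is required
  to be nonempty, so that homomorphism densities into the graph are defined.
\<close>

definition finite_graph :: "'a pair_pre_digraph \<Rightarrow> bool" where
  "finite_graph G \<longleftrightarrow> pair_graph G \<and> pverts G \<noteq> {}"

definition graph_compl :: "'a pair_pre_digraph \<Rightarrow> 'a pair_pre_digraph" where
  "graph_compl G = \<lparr> pverts = pverts G,
     parcs = {(u, v). u \<in> pverts G \<and> v \<in> pverts G \<and> u \<noteq> v \<and> (u, v) \<notin> parcs G} \<rparr>"

definition graph_homs :: "'a pair_pre_digraph \<Rightarrow> 'b pair_pre_digraph \<Rightarrow> ('a \<Rightarrow> 'b) set" where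
  "graph_homs H G =
     {f \<in> pverts H \<rightarrow>\<^sub>E pverts G. \<forall>(u, v) \<in> parcs H. (f u, f v) \<in> parcs G}"

definition hom_density :: "'a pair_pre_digraph \<Rightarrow> 'b pair_pre_digraph \<Rightarrow> real" where
  "hom_density H G = real (card (graph_homs H G)) / real (card (pverts G)) ^ card (pverts H)"

text \<open>The cycle on the vertices \<open>0, \<dots>, n - 1\<close>; meaningful for \<open>n \<ge> 3\<close>.\<close>

definition cycle_graph :: "nat \<Rightarrow> nat pair_pre_digraph" where
  "cycle_graph n = \<lparr> pverts = {..<n},
     parcs = {(i, Suc i mod n) | i. i < n} \<union> {(Suc i mod n, i) | i. i < n} \<rparr>"

definition banner_graph :: "nat pair_pre_digraph" where
  "banner_graph = \<lparr> pverts = insert 4 (pverts (cycle_graph 4)),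
     parcs = parcs (cycle_graph 4) \<union> {(0, 4), (4, 0)} \<rparr>"

text \<open>
  A sequence containing every finite graph exactly once, up to isomorphism. Nothing is lost by
  taking vertices in \<open>nat\<close>, since every finite graph is isomorphic to one with such vertices.
\<close>

definition graph_enumeration :: "(nat \<Rightarrow> nat pair_pre_digraph) \<Rightarrow> bool" where
  "graph_enumeration G \<longleftrightarrow>
     (\<forall>n. finite_graph (G n)) \<and>
     (\<forall>H :: nat pair_pre_digraph. finite_graph H \<longrightarrow>
        (\<exists>!n. digraph_iso (with_proj (G n)) (with_proj H)))"

text \<open>
  The limit inferior and the supremum are taken in the extended reals, a complete lattice, so that
  neither can be affected by a default value.
\<close>

definition c_lambda ::
  "(nat \<Rightarrow> 'c pair_pre_digraph) \<Rightarrow> real \<Rightarrow> 'a pair_pre_digraph \<Rightarrow> 'b pair_pre_digraph \<Rightarrow> ereal" where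
  "c_lambda G lam H\<^sub>1 H\<^sub>2 =
     liminf (\<lambda>n. ereal (lam * hom_density H\<^sub>1 (G n) +
                        (2 - lam) * hom_density H\<^sub>2 (graph_compl (G n))))"

definition c_max ::
  "(nat \<Rightarrow> 'c pair_pre_digraph) \<Rightarrow> 'a pair_pre_digraph \<Rightarrow> 'b pair_pre_digraph \<Rightarrow> ereal" where
  "c_max G H\<^sub>1 H\<^sub>2 = (SUP lam\<in>{0..2}. c_lambda G lam H\<^sub>1 H\<^sub>2)"

end

theory Submission
  imports Defs
begin

text \<open>
  Let \<open>A\<close> be the symmetric matrix with entry \<open>1\<close> on edges and \<open>-1\<close> on non-edges, so that the two
  densities are averages of products of five factors \<open>(1 + A)/2\<close>, respectively \<open>(1 - A)/2\<close>. In the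
  expansion of the sum of the two averages the linear terms cancel. With \<open>d\<close> the row averages of
  \<open>A\<close>, all remaining terms except \<open>t(C\<^sub>4, A) + t(C\<^sub>5, A) - t(B, A)\<close> are controlled by the
  average of \<open>d\<^sup>2\<close>, which occurs with the large coefficient 11. The exceptional combination is a sum
  over the rows \<open>v\<close> of \<open>A\<^sup>2\<close> of the quadratic forms \<open>|v|\<^sup>2 + \<langle>v, A v\<rangle> - \<langle>d, v\<^sup>2\<rangle>\<close>, and each of them equals
  the average of \<open>(1 - A x y) (v x - v y)\<^sup>2 / 2 + v x * v y\<close>, hence is nonnegative. Replacing \<open>1 - A\<close>
  by the complement of the graph only affects non-injective maps, which are negligible because the
  number of vertices tends to infinity along the enumeration. For the upper bound, averaging over
  all graphs on a given large vertex set gives \<open>\<lambda>/32 + (2 - \<lambda>)/32 = 1/16\<close> up to the contribution of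
  non-injective maps, whatever \<open>\<lambda>\<close> is.
\<close>

section \<open>Signed kernels\<close>

locale signed_kernel =
  fixes V :: "'a set" and A :: "'a \<Rightarrow> 'a \<Rightarrow> real"
  assumes finite_V: "finite V"
    and sym: "A x y = A y x"
    and bound: "\<bar>A x y\<bar> \<le> 1"
begin

section \<open>The matrix as an operator and its degree vectors\<close>

abbreviation n :: real where "n \<equiv> real (card V)"
text \<open>All sums are left unnormalised, so an average over \<open>k\<close> vertices appears
  multiplied by \<open>n ^ k\<close>. \<open>app\<close> multiplies a vector by the matrix A; hence
  \<open>d\<close> is A1, \<open>d2\<close> is A^2 1 and \<open>A2\<close> is the matrix
  square.\<close>

definition app :: "('a \<Rightarrow> real) \<Rightarrow> 'a \<Rightarrow> real" where "app f x = (\<Sum>y\<in>V. A x y * f y)"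
definition d :: "'a \<Rightarrow> real" where "d = app (\<lambda>_. 1)"
definition d2 :: "'a \<Rightarrow> real" where "d2 = app d"
definition e :: real where "e = sum d V"
definition A2 :: "'a \<Rightarrow> 'a \<Rightarrow> real" where "A2 x = app (A x)"

lemma sum_d [simp]: "sum d V = e"
  by (simp add: e_def)

lemma app_add: "app (\<lambda>y. f y + g y) x = app f x + app g x"
  by (simp add: app_def sum.distrib algebra_simps)

lemma app_cmult: "app (\<lambda>y. c * f y) x = c * app f x"
  by (simp add: app_def sum_distrib_left algebra_simps)

lemma app_const: "app (\<lambda>y. c) x = c * d x"
  using app_cmult[of c "\<lambda>_. 1"] by (simp add: d_def)

text \<open>Symmetry makes A self-adjoint; this brings the moments below to a form in
  \<open>d\<close>, \<open>d2\<close> and \<open>A2\<close>.\<close>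

lemma app_adjoint: "(\<Sum>x\<in>V. f x * app g x) = (\<Sum>x\<in>V. app f x * g x)"
  unfolding app_def sum_distrib_left sum_distrib_right
  by (subst sum.swap) (simp add: sym mult_ac)

lemma sum_app: "sum (app f) V = (\<Sum>x\<in>V. d x * f x)"
  using app_adjoint[of "\<lambda>_. 1" f] by (simp add: d_def)

lemma A2_sym: "A2 x y = A2 y x"
  unfolding A2_def app_def by (intro sum.cong) (simp_all add: sym mult.commute)

lemma sum_A2: "(\<Sum>z\<in>V. A2 x z * f z) = app (app f) x"
proof -
  have "(\<Sum>z\<in>V. A2 x z * f z) = (\<Sum>z\<in>V. app (A x) z * f z)" by (simp add: A2_def)
  also have "\<dots> = (\<Sum>z\<in>V. A x z * app f z)" by (rule app_adjoint[symmetric])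
  finally show ?thesis by (simp add: app_def)
qed

lemma abs_app_le:
  assumes "\<And>x. x \<in> V \<Longrightarrow> \<bar>f x\<bar> \<le> c"
  shows "\<bar>app f x\<bar> \<le> n * c"
proof -
  have "\<bar>app f x\<bar> \<le> (\<Sum>y\<in>V. \<bar>A x y * f y\<bar>)" unfolding app_def by (rule sum_abs)
  also have "\<dots> \<le> (\<Sum>y\<in>V. c)"
  proof (rule sum_mono)
    fix y assume y: "y \<in> V"
    have "\<bar>A x y\<bar> * \<bar>f y\<bar> \<le> 1 * c"
      by (rule mult_mono) (use assms[OF y] bound in auto)
    then show "\<bar>A x y * f y\<bar> \<le> c" by (simp add: abs_mult)
  qed
  finally show ?thesis by simp
qed

lemma abs_d_le: "\<bar>d x\<bar> \<le> n"
  using abs_app_le[of "\<lambda>_. 1" 1] by (simp add: d_def)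

lemma abs_d2_le: "\<bar>d2 x\<bar> \<le> n\<^sup>2"
  using abs_app_le[of d n] abs_d_le by (simp add: d2_def power2_eq_square)

lemma abs_e_le: "\<bar>e\<bar> \<le> n\<^sup>2"
proof -
  have "\<bar>sum d V\<bar> \<le> (\<Sum>x\<in>V. \<bar>d x\<bar>)" by (rule sum_abs)
  also have "\<dots> \<le> (\<Sum>x\<in>V. n)" by (intro sum_mono abs_d_le)
  finally show ?thesis by (simp add: power2_eq_square)
qed

section \<open>Inequalities for quadratic forms\<close>

text \<open>Each entry has absolute value at most 1, so every product is bounded by the mean of two
  squares; in other words, no eigenvalue of A exceeds \<open>n\<close>.\<close>

lemma quadratic_form_le: "(\<Sum>x\<in>V. f x * app f x) \<le> n * (\<Sum>x\<in>V. (f x)\<^sup>2)"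
proof -
  have "(\<Sum>x\<in>V. f x * app f x) \<le> (\<Sum>x\<in>V. \<Sum>y\<in>V. ((f x)\<^sup>2 + (f y)\<^sup>2) / 2)"
    unfolding app_def sum_distrib_left
  proof (intro sum_mono)
    fix x y
    have "f x * (A x y * f y) \<le> \<bar>A x y\<bar> * \<bar>f x * f y\<bar>"
      by (metis abs_ge_self abs_mult mult.left_commute)
    also have "\<dots> \<le> 1 * \<bar>f x * f y\<bar>"
      by (rule mult_right_mono) (use bound in auto)
    also have "\<dots> \<le> ((f x)\<^sup>2 + (f y)\<^sup>2) / 2"
      using sum_squares_bound[of "\<bar>f x\<bar>" "\<bar>f y\<bar>"] by (simp add: abs_mult)
    finally show "f x * (A x y * f y) \<le> ((f x)\<^sup>2 + (f y)\<^sup>2) / 2" .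
  qed
  also have "\<dots> = n * (\<Sum>x\<in>V. (f x)\<^sup>2)"
    by (simp add: sum.distrib add_divide_distrib flip: sum_divide_distrib sum_distrib_left)
  finally show ?thesis .
qed

text \<open>The weights \<open>(1 - A x y) / 2\<close> are nonnegative, so their Laplacian form is
  too. Its cross term is \<open>(A x y - 1) * v x * v y\<close>; adding the square of the sum of
  \<open>v\<close> removes the -1 and leaves the form of A.\<close>

lemma degree_form_nonneg:
  "0 \<le> n * (\<Sum>x\<in>V. (v x)\<^sup>2) + (\<Sum>x\<in>V. v x * app v x) - (\<Sum>x\<in>V. d x * (v x)\<^sup>2)"
proof -
  have "0 \<le> (\<Sum>x\<in>V. \<Sum>y\<in>V. (1 - A x y) / 2 * (v x - v y)\<^sup>2)"
    by (intro sum_nonneg mult_nonneg_nonneg) (use bound in \<open>auto simp: abs_le_iff\<close>)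
  moreover have "0 \<le> (\<Sum>x\<in>V. \<Sum>y\<in>V. v x * v y)"
    by (simp flip: sum_distrib_left sum_distrib_right)
  moreover have "(\<Sum>x\<in>V. \<Sum>y\<in>V. (1 - A x y) / 2 * (v x - v y)\<^sup>2) + (\<Sum>x\<in>V. \<Sum>y\<in>V. v x * v y)
     = (\<Sum>x\<in>V. \<Sum>y\<in>V. (v x)\<^sup>2 / 2) + (\<Sum>x\<in>V. \<Sum>y\<in>V. (v y)\<^sup>2 / 2)
       + (\<Sum>x\<in>V. \<Sum>y\<in>V. v x * (A x y * v y))
       - (\<Sum>x\<in>V. \<Sum>y\<in>V. A x y * (v x)\<^sup>2) / 2 - (\<Sum>x\<in>V. \<Sum>y\<in>V. A x y * (v y)\<^sup>2) / 2"
    unfolding sum_divide_distrib sum.distrib[symmetric] sum_subtractf[symmetric]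
    by (intro sum.cong refl) (simp add: field_simps power2_eq_square)
  moreover have "(\<Sum>x\<in>V. \<Sum>y\<in>V. v x * (A x y * v y)) = (\<Sum>x\<in>V. v x * app v x)"
    by (simp add: app_def sum_distrib_left)
  moreover have "(\<Sum>x\<in>V. \<Sum>y\<in>V. A x y * (v x)\<^sup>2) = (\<Sum>x\<in>V. d x * (v x)\<^sup>2)"
    by (simp add: d_def app_def sum_distrib_right)
  moreover have "(\<Sum>x\<in>V. \<Sum>y\<in>V. A x y * (v y)\<^sup>2) = (\<Sum>x\<in>V. d x * (v x)\<^sup>2)"
    using sum_app[of "\<lambda>y. (v y)\<^sup>2"] by (simp add: app_def)
  moreover have "(\<Sum>x\<in>V. \<Sum>y\<in>V. (v x)\<^sup>2 / 2) + (\<Sum>x\<in>V. \<Sum>y\<in>V. (v y)\<^sup>2 / 2)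
     = n * (\<Sum>x\<in>V. (v x)\<^sup>2)"
    by (simp flip: sum_divide_distrib sum_distrib_left)
  ultimately show ?thesis by linarith
qed

text \<open>Apply the previous form to every row \<open>A2 x\<close> and add up; symmetry of
  \<open>A2\<close> moves the degree weight from \<open>z\<close> to \<open>x\<close>. The three
  terms are the unnormalised densities in A of the 4-cycle (times \<open>n\<close>), the 5-cycle
  (the trace of A^5) and the banner.\<close>

lemma cycles_minus_banner_nonneg:
  "0 \<le> n * (\<Sum>x\<in>V. \<Sum>z\<in>V. (A2 x z)\<^sup>2) + (\<Sum>x\<in>V. \<Sum>z\<in>V. A2 x z * app (A2 x) z)
     - (\<Sum>x\<in>V. d x * (\<Sum>z\<in>V. (A2 x z)\<^sup>2))"
proof -
  have "0 \<le> (\<Sum>x\<in>V. n * (\<Sum>z\<in>V. (A2 x z)\<^sup>2) + (\<Sum>z\<in>V. A2 x z * app (A2 x) z)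
     - (\<Sum>z\<in>V. d z * (A2 x z)\<^sup>2))"
    by (intro sum_nonneg degree_form_nonneg)
  also have "\<dots> = n * (\<Sum>x\<in>V. \<Sum>z\<in>V. (A2 x z)\<^sup>2) + (\<Sum>x\<in>V. \<Sum>z\<in>V. A2 x z * app (A2 x) z)
     - (\<Sum>x\<in>V. \<Sum>z\<in>V. d z * (A2 x z)\<^sup>2)"
    by (simp add: sum.distrib sum_subtractf sum_distrib_left)
  also have "(\<Sum>x\<in>V. \<Sum>z\<in>V. d z * (A2 x z)\<^sup>2) = (\<Sum>x\<in>V. d x * (\<Sum>z\<in>V. (A2 x z)\<^sup>2))"
    by (subst sum.swap) (simp add: sum_distrib_left A2_sym)
  finally show ?thesis .
qed

section \<open>Expansion of the two homomorphism sums into moments\<close>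

text \<open>The sign \<open>s\<close> treats 1 + A and 1 - A together: as \<open>s * s = 1\<close>,
  the quadratic term is the same for both.\<close>

lemma sum_two_path:
  assumes "s = 1 \<or> s = -1"
  shows "(\<Sum>y\<in>V. (1 + s * A x y) * (1 + s * A y z)) = n + s * (d x + d z) + A2 x z"
proof -
  have "(\<Sum>y\<in>V. (1 + s * A x y) * (1 + s * A y z))
      = (\<Sum>y\<in>V. 1 + s * A x y + s * A z y + s * s * (A z y * A x y))"
    by (intro sum.cong refl) (simp add: algebra_simps sym)
  also have "\<dots> = n + s * d x + s * d z + s * s * A2 x z"
    by (simp add: sum.distrib d_def A2_def app_def flip: sum_distrib_left)
  finally show ?thesis using assms by (auto simp: algebra_simps)
qed

text \<open>Here \<open>x\<close> is the vertex of degree three and \<open>z\<close> the one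
  opposite to it. Once both are fixed, \<open>b\<close>, \<open>b'\<close> and the leaf
  \<open>l\<close> are independent, and the sum factors. The coefficients count edge subsets of the
  banner by shape, with sign according to their size: 6 adjacent and 4 disjoint pairs, 6 three-edge
  paths, one star, and so on.\<close>

lemma sum_banner:
  "(\<Sum>x\<in>V. \<Sum>z\<in>V. \<Sum>b\<in>V. \<Sum>b'\<in>V. \<Sum>l\<in>V.
      (1 - A x b) * (1 - A b z) * (1 - A z b') * (1 - A b' x) * (1 - A x l))
   = n ^ 5 - 5 * n ^ 3 * e + 6 * n\<^sup>2 * (\<Sum>x\<in>V. (d x)\<^sup>2) + 4 * n * e\<^sup>2
     - 6 * n * (\<Sum>x\<in>V. d x * d2 x) - n * (\<Sum>x\<in>V. d x ^ 3) - 3 * e * (\<Sum>x\<in>V. (d x)\<^sup>2)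
     + n * (\<Sum>x\<in>V. \<Sum>z\<in>V. (A2 x z)\<^sup>2) + 2 * (\<Sum>x\<in>V. (d2 x)\<^sup>2) + 2 * (\<Sum>x\<in>V. (d x)\<^sup>2 * d2 x)
     - (\<Sum>x\<in>V. d x * (\<Sum>z\<in>V. (A2 x z)\<^sup>2))"
   (is "?L = ?R")
proof -
  define q where "q x = (\<Sum>z\<in>V. (A2 x z)\<^sup>2)" for x
  \<comment> \<open>Self-adjointness disposes of \<open>app d2\<close>, which is A^3 1.\<close>
  have d3: "(\<Sum>x\<in>V. app d2 x) = (\<Sum>x\<in>V. d x * d2 x)"
    by (simp add: sum_app)
  have dd3: "(\<Sum>x\<in>V. d x * app d2 x) = (\<Sum>x\<in>V. (d2 x)\<^sup>2)"
    using app_adjoint[of d d2] by (simp add: d2_def power2_eq_square)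
  have two: "(\<Sum>b\<in>V. (1 - A x b) * (1 - A b z)) = n - d x - d z + A2 x z" for x z
    using sum_two_path[of "-1" x z] by simp
  have leaf: "(\<Sum>l\<in>V. 1 - A x l) = n - d x" for x
    by (simp add: sum_subtractf d_def app_def)
  have "?L = (\<Sum>x\<in>V. (n - d x) * (\<Sum>z\<in>V. (n - d x - d z + A2 x z)\<^sup>2))"
  proof (intro sum.cong refl)
    fix x
    have "(\<Sum>z\<in>V. \<Sum>b\<in>V. \<Sum>b'\<in>V. \<Sum>l\<in>V.
      (1 - A x b) * (1 - A b z) * (1 - A z b') * (1 - A b' x) * (1 - A x l))
      = (\<Sum>z\<in>V. (\<Sum>b\<in>V. (1 - A x b) * (1 - A b z))
          * ((\<Sum>b'\<in>V. (1 - A z b') * (1 - A b' x)) * (\<Sum>l\<in>V. 1 - A x l)))"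
      unfolding sum_distrib_right unfolding sum_distrib_left by (simp add: mult_ac)
    also have "\<dots> = (\<Sum>z\<in>V. (n - d x) * (n - d x - d z + A2 x z)\<^sup>2)"
      unfolding two leaf by (intro sum.cong refl) (simp add: power2_eq_square A2_sym algebra_simps)
    finally show "(\<Sum>z\<in>V. \<Sum>b\<in>V. \<Sum>b'\<in>V. \<Sum>l\<in>V.
      (1 - A x b) * (1 - A b z) * (1 - A z b') * (1 - A b' x) * (1 - A x l))
      = (n - d x) * (\<Sum>z\<in>V. (n - d x - d z + A2 x z)\<^sup>2)"
      by (simp only: sum_distrib_left)
  qed
  also have "\<dots> = (\<Sum>x\<in>V. (n - d x) * (n * (n - d x)\<^sup>2 + (\<Sum>z\<in>V. (d z)\<^sup>2) + q x
      - 2 * (n - d x) * e + 2 * (n - d x) * d2 x - 2 * app d2 x))"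
  proof (intro sum.cong refl arg_cong2[where f = "(*)"])
    fix x
    have "(\<Sum>z\<in>V. (n - d x - d z + A2 x z)\<^sup>2)
      = (\<Sum>z\<in>V. (n - d x)\<^sup>2 + (d z)\<^sup>2 + (A2 x z)\<^sup>2 - 2 * (n - d x) * d z
           + 2 * (n - d x) * (A2 x z * 1) - 2 * (A2 x z * d z))"
      by (intro sum.cong refl) (simp add: power2_eq_square algebra_simps)
    also have "\<dots> = n * (n - d x)\<^sup>2 + (\<Sum>z\<in>V. (d z)\<^sup>2) + q x
      - 2 * (n - d x) * e + 2 * (n - d x) * app (app (\<lambda>_. 1)) x - 2 * app (app d) x"
      unfolding sum_A2[symmetric]
      by (simp add: sum.distrib sum_subtractf q_def flip: sum_distrib_left)
    finally show "(\<Sum>z\<in>V. (n - d x - d z + A2 x z)\<^sup>2)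
      = n * (n - d x)\<^sup>2 + (\<Sum>z\<in>V. (d z)\<^sup>2) + q x
      - 2 * (n - d x) * e + 2 * (n - d x) * d2 x - 2 * app d2 x"
      by (simp add: d2_def d_def)
  qed
  \<comment> \<open>Collected so that every summand is a constant times a single moment.\<close>
  also have "\<dots> = (\<Sum>x\<in>V. n * n * n * n + (- 3 * n * n * n - (\<Sum>z\<in>V. (d z)\<^sup>2) + 4 * n * e) * d x
      + (3 * n * n - 2 * e) * (d x)\<^sup>2 - n * d x ^ 3 + n * (\<Sum>z\<in>V. (d z)\<^sup>2) - 2 * n * n * e
      + n * q x - d x * q x + 2 * n * n * d2 x - 4 * n * (d x * d2 x) + 2 * ((d x)\<^sup>2 * d2 x)
      - 2 * n * app d2 x + 2 * (d x * app d2 x))"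
    by (intro sum.cong refl) (simp add: power2_eq_square power3_eq_cube algebra_simps)
  also have "\<dots> = ?R"
  proof -
    have "sum d2 V = (\<Sum>x\<in>V. (d x)\<^sup>2)"
      by (simp add: d2_def sum_app power2_eq_square)
    then show ?thesis
      by (simp add: sum.distrib sum_subtractf d3 dd3 flip: sum_distrib_left)
        (simp add: q_def power2_eq_square algebra_simps eval_nat_numeral)
  qed
  finally show ?thesis .
qed

text \<open>Cutting the cycle at \<open>x\<close> and \<open>z\<close> leaves a path through
  \<open>b\<close> and a path through \<open>c\<close> and \<open>c'\<close>; their sums factor. As
  before, the coefficients count edge subsets of the 5-cycle by shape: five of each shape, except
  for the empty set and the whole cycle.\<close>

lemma sum_five_cycle:
  "(\<Sum>x\<in>V. \<Sum>z\<in>V. \<Sum>b\<in>V. \<Sum>c\<in>V. \<Sum>c'\<in>V.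
      (1 + A x b) * (1 + A b z) * (1 + A z c) * (1 + A c c') * (1 + A c' x))
   = n ^ 5 + 5 * n ^ 3 * e + 5 * n\<^sup>2 * (\<Sum>x\<in>V. (d x)\<^sup>2) + 5 * n * e\<^sup>2
     + 5 * n * (\<Sum>x\<in>V. d x * d2 x) + 5 * e * (\<Sum>x\<in>V. (d x)\<^sup>2)
     + 5 * (\<Sum>x\<in>V. (d2 x)\<^sup>2) + (\<Sum>x\<in>V. \<Sum>z\<in>V. A2 x z * app (A2 x) z)"
   (is "?L = ?R")
proof -
  have sd2: "sum d2 V = (\<Sum>x\<in>V. (d x)\<^sup>2)"
    by (simp add: d2_def sum_app power2_eq_square)
  have d3: "(\<Sum>x\<in>V. app d2 x) = (\<Sum>x\<in>V. d x * d2 x)"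
    by (simp add: sum_app)
  have dd3: "(\<Sum>x\<in>V. d x * app d2 x) = (\<Sum>x\<in>V. (d2 x)\<^sup>2)"
    using app_adjoint[of d d2] by (simp add: d2_def power2_eq_square)
  \<comment> \<open>The constant \<open>n\<close> of the two-path sum is split evenly between the
    endpoints, so that it reads \<open>p x + p z + A2 x z\<close>. Then \<open>r\<close> and
    \<open>s\<close> gather the parts of the three-path sum that depend on one endpoint
    only.\<close>
  define p where "p x = n / 2 + d x" for x
  define r where "r x = sum p V + app p x" for x
  define s where "s x = n * p x + d2 x" for x
  have app_p: "app p = (\<lambda>x. n / 2 * d x + d2 x)"
    unfolding p_def using app_add[of "\<lambda>_. n / 2" d] by (auto simp: app_const d2_def)
  have two: "(\<Sum>y\<in>V. (1 + A x y) * (1 + A y z)) = p x + p z + A2 x z" for x z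
    using sum_two_path[of 1 x z] by (simp add: p_def)
  have three: "(\<Sum>y\<in>V. (1 + A z y) * (p y + p x + A2 y x)) = r z + s x + d z * p x + app (A2 x) z" for x z
  proof -
    have "(\<Sum>y\<in>V. (1 + A z y) * (p y + p x + A2 y x))
      = (\<Sum>y\<in>V. p y + p x + A2 x y * 1 + A z y * p y + p x * (A z y * 1) + A z y * A2 x y)"
      by (intro sum.cong refl) (simp add: algebra_simps A2_sym)
    also have "\<dots> = sum p V + n * p x + app (app (\<lambda>_. 1)) x + app p z + p x * app (\<lambda>_. 1) z + app (A2 x) z"
      unfolding sum_A2[symmetric]
      by (simp add: sum.distrib app_def flip: sum_distrib_left)
    finally show ?thesis by (simp add: r_def s_def d2_def d_def algebra_simps)
  qed
  have "?L = (\<Sum>x\<in>V. \<Sum>z\<in>V. (p x + p z + A2 x z) * (r z + s x + d z * p x + app (A2 x) z))"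
  proof (rule sum.cong[OF refl])
    fix x
    have "(\<Sum>z\<in>V. \<Sum>b\<in>V. \<Sum>c\<in>V. \<Sum>c'\<in>V.
      (1 + A x b) * (1 + A b z) * (1 + A z c) * (1 + A c c') * (1 + A c' x))
      = (\<Sum>z\<in>V. (\<Sum>b\<in>V. (1 + A x b) * (1 + A b z)) * (\<Sum>c\<in>V. (1 + A z c) * (\<Sum>c'\<in>V. (1 + A c c') * (1 + A c' x))))"
      unfolding sum_distrib_right unfolding sum_distrib_left by (simp add: mult_ac)
    then show "(\<Sum>z\<in>V. \<Sum>b\<in>V. \<Sum>c\<in>V. \<Sum>c'\<in>V.
      (1 + A x b) * (1 + A b z) * (1 + A z c) * (1 + A c c') * (1 + A c' x))
      = (\<Sum>z\<in>V. (p x + p z + A2 x z) * (r z + s x + d z * p x + app (A2 x) z))"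
      unfolding two three .
  qed
  \<comment> \<open>Three terms times four give twelve products, each summed over
    \<open>z\<close>.\<close>
  also have "\<dots> = (\<Sum>x\<in>V. p x * sum r V + n * (p x * s x) + p x * p x * e + p x * sum (app (A2 x)) V
       + (\<Sum>z\<in>V. p z * r z) + s x * sum p V + p x * (\<Sum>z\<in>V. p z * d z) + (\<Sum>z\<in>V. p z * app (A2 x) z)
       + app (app r) x + s x * app (app (\<lambda>_. 1)) x + p x * app (app d) x + (\<Sum>z\<in>V. A2 x z * app (A2 x) z))"
  proof (intro sum.cong refl)
    fix x
    have "(\<Sum>z\<in>V. (p x + p z + A2 x z) * (r z + s x + d z * p x + app (A2 x) z))
     = (\<Sum>z\<in>V. p x * r z + p x * s x + p x * p x * d z + p x * app (A2 x) z
       + p z * r z + s x * p z + p x * (p z * d z) + p z * app (A2 x) z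
       + A2 x z * r z + s x * (A2 x z * 1) + p x * (A2 x z * d z) + A2 x z * app (A2 x) z)"
      by (intro sum.cong refl) (simp add: algebra_simps)
    then show "(\<Sum>z\<in>V. (p x + p z + A2 x z) * (r z + s x + d z * p x + app (A2 x) z))
      = p x * sum r V + n * (p x * s x) + p x * p x * e + p x * sum (app (A2 x)) V
       + (\<Sum>z\<in>V. p z * r z) + s x * sum p V + p x * (\<Sum>z\<in>V. p z * d z) + (\<Sum>z\<in>V. p z * app (A2 x) z)
       + app (app r) x + s x * app (app (\<lambda>_. 1)) x + p x * app (app d) x + (\<Sum>z\<in>V. A2 x z * app (A2 x) z)"
      unfolding sum_A2[symmetric]
      by (simp add: sum.distrib flip: sum_distrib_left)
  qed
  also have "\<dots> = ?R"
  proof -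
    have a1: "sum (app (A2 x)) V = app d2 x" for x
      by (simp add: sum_app d2_def flip: sum_A2) (simp add: mult.commute)
    have a2: "(\<Sum>z\<in>V. p z * app (A2 x) z) = app (app (app p)) x" for x
      unfolding app_adjoint by (simp add: mult.commute flip: sum_A2)
    \<comment> \<open>The first three are the sums of all entries of A^2, A^3 and A^4;
      \<open>?C\<close> is the trace of A^5. The facts below express each of the twelve sums through
      these, \<open>n\<close> and \<open>e\<close>.\<close>
    let ?S = "\<Sum>x\<in>V. (d x)\<^sup>2" and ?T = "\<Sum>x\<in>V. d x * d2 x" and ?U = "\<Sum>x\<in>V. (d2 x)\<^sup>2"
      and ?C = "\<Sum>x\<in>V. \<Sum>z\<in>V. A2 x z * app (A2 x) z"
    have P: "sum p V = n\<^sup>2 / 2 + e"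
      by (simp add: p_def sum.distrib power2_eq_square)
    have r: "r x = sum p V + n / 2 * d x + d2 x" for x
      by (simp add: r_def app_p)
    have s: "s x = n\<^sup>2 / 2 + n * d x + d2 x" for x
      by (simp add: s_def p_def power2_eq_square algebra_simps)
    have pd: "(\<Sum>x\<in>V. p x * d x) = n / 2 * e + ?S"
      by (simp add: p_def sum.distrib algebra_simps power2_eq_square flip: sum_distrib_left sum_divide_distrib)
    have pd2: "(\<Sum>x\<in>V. p x * d2 x) = n / 2 * ?S + ?T"
      by (simp add: p_def sum.distrib algebra_simps sd2 flip: sum_distrib_left sum_divide_distrib)
    have pd3: "(\<Sum>x\<in>V. p x * app d2 x) = n / 2 * ?T + ?U"
      by (simp add: p_def sum.distrib algebra_simps d3 dd3 flip: sum_distrib_left sum_divide_distrib)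
    have pp: "(\<Sum>x\<in>V. p x * p x) = n / 2 * sum p V + n / 2 * e + ?S"
    proof -
      have "(\<Sum>x\<in>V. p x * p x) = (\<Sum>x\<in>V. n / 2 * p x + p x * d x)"
        by (intro sum.cong refl) (simp add: p_def algebra_simps)
      then show ?thesis by (simp only: sum.distrib pd add.assoc flip: sum_distrib_left)
    qed
    have ps: "(\<Sum>x\<in>V. p x * s x) = n\<^sup>2 / 2 * sum p V + n * (n / 2 * e + ?S) + (n / 2 * ?S + ?T)"
    proof -
      have "(\<Sum>x\<in>V. p x * s x) = (\<Sum>x\<in>V. n\<^sup>2 / 2 * p x + n * (p x * d x) + p x * d2 x)"
        by (intro sum.cong refl) (simp add: s algebra_simps)
      then show ?thesis by (simp only: sum.distrib pd pd2 flip: sum_distrib_left)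
    qed
    have pr: "(\<Sum>x\<in>V. p x * r x) = sum p V * sum p V + n / 2 * (n / 2 * e + ?S) + (n / 2 * ?S + ?T)"
    proof -
      have "(\<Sum>x\<in>V. p x * r x) = (\<Sum>x\<in>V. sum p V * p x + n / 2 * (p x * d x) + p x * d2 x)"
        by (intro sum.cong refl) (simp add: r algebra_simps)
      then show ?thesis by (simp only: sum.distrib pd pd2 flip: sum_distrib_left)
    qed
    have sr: "sum r V = n * sum p V + n / 2 * e + ?S"
      by (simp add: r sum.distrib sd2 flip: sum_distrib_left sum_divide_distrib)
    have ss: "sum s V = n ^ 3 / 2 + n * e + ?S"
      by (simp add: s sum.distrib sd2 power2_eq_square power3_eq_cube flip: sum_distrib_left)
    have sd: "(\<Sum>x\<in>V. s x * d2 x) = n\<^sup>2 / 2 * ?S + n * ?T + ?U"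
    proof -
      have "(\<Sum>x\<in>V. s x * d2 x) = (\<Sum>x\<in>V. n\<^sup>2 / 2 * d2 x + n * (d x * d2 x) + (d2 x)\<^sup>2)"
        by (intro sum.cong refl) (simp add: s algebra_simps power2_eq_square)
      then show ?thesis by (simp only: sum.distrib sd2 flip: sum_distrib_left)
    qed
    have rr: "(\<Sum>x\<in>V. app (app r) x) = sum p V * ?S + n / 2 * ?T + ?U"
    proof -
      have "(\<Sum>x\<in>V. app (app r) x) = (\<Sum>x\<in>V. d2 x * r x)"
        by (simp add: sum_app app_adjoint d2_def)
      also have "\<dots> = (\<Sum>x\<in>V. sum p V * d2 x + n / 2 * (d x * d2 x) + (d2 x)\<^sup>2)"
        by (intro sum.cong refl) (simp add: r algebra_simps power2_eq_square)
      finally show ?thesis by (simp only: sum.distrib sd2 flip: sum_distrib_left)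
    qed
    have appp: "(\<Sum>x\<in>V. app (app (app p)) x) = n / 2 * ?T + ?U"
    proof -
      have "(\<Sum>x\<in>V. app (app (app p)) x) = (\<Sum>x\<in>V. d2 x * app p x)"
        by (simp add: sum_app app_adjoint d2_def)
      also have "\<dots> = (\<Sum>x\<in>V. n / 2 * (d x * d2 x) + (d2 x)\<^sup>2)"
        by (intro sum.cong refl) (simp add: app_p algebra_simps power2_eq_square)
      finally show ?thesis by (simp only: sum.distrib flip: sum_distrib_left)
    qed
    have "(\<Sum>x\<in>V. p x * sum r V + n * (p x * s x) + p x * p x * e + p x * sum (app (A2 x)) V
       + (\<Sum>z\<in>V. p z * r z) + s x * sum p V + p x * (\<Sum>z\<in>V. p z * d z) + (\<Sum>z\<in>V. p z * app (A2 x) z)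
       + app (app r) x + s x * app (app (\<lambda>_. 1)) x + p x * app (app d) x + (\<Sum>z\<in>V. A2 x z * app (A2 x) z))
      = sum p V * sum r V + n * (\<Sum>x\<in>V. p x * s x) + (\<Sum>x\<in>V. p x * p x) * e + (\<Sum>x\<in>V. p x * app d2 x)
       + n * (\<Sum>z\<in>V. p z * r z) + sum s V * sum p V + sum p V * (\<Sum>z\<in>V. p z * d z) + (\<Sum>x\<in>V. app (app (app p)) x)
       + (\<Sum>x\<in>V. app (app r) x) + (\<Sum>x\<in>V. s x * d2 x) + (\<Sum>x\<in>V. p x * app d2 x) + ?C"
      by (simp add: sum.distrib a1 a2 flip: sum_distrib_left sum_distrib_right d_def d2_def)
    also have "\<dots> = ?R"
      unfolding appp rr sd ss sr pr ps pp pd3 pd P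
      by (simp add: field_simps eval_nat_numeral)
    finally show ?thesis .
  qed
  finally show ?thesis .
qed

text \<open>On adding the expansions the terms \<open>5 * n ^ 3 * e\<close> cancel and
  \<open>n\<^sup>2 * ?S\<close> has coefficient 11. The terms of indefinite sign, in
  \<open>d x * d2 x\<close>, \<open>d x ^ 3\<close>, \<open>e * ?S\<close> and
  \<open>(d x)\<^sup>2 * d2 x\<close>, have coefficients -1, -1, 2 and 2, so they cost at most 1 + 1
  + 2 + 2 = 6 copies of \<open>n\<^sup>2 * ?S\<close>. The rest is nonnegative.\<close>

lemma five_cycle_plus_banner_ge:
  "2 * n ^ 5 \<le>
   (\<Sum>x\<in>V. \<Sum>z\<in>V. \<Sum>b\<in>V. \<Sum>c\<in>V. \<Sum>c'\<in>V.
      (1 + A x b) * (1 + A b z) * (1 + A z c) * (1 + A c c') * (1 + A c' x)) +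
   (\<Sum>x\<in>V. \<Sum>z\<in>V. \<Sum>b\<in>V. \<Sum>b'\<in>V. \<Sum>l\<in>V.
      (1 - A x b) * (1 - A b z) * (1 - A z b') * (1 - A b' x) * (1 - A x l))"
proof -
  let ?S = "\<Sum>x\<in>V. (d x)\<^sup>2"
  have S: "0 \<le> ?S" by (simp add: sum_nonneg)
  have "n * (\<Sum>x\<in>V. d x * d2 x) \<le> n * (n * ?S)"
    unfolding d2_def by (intro mult_left_mono quadratic_form_le) simp
  moreover have "n * (\<Sum>x\<in>V. d x ^ 3) \<le> n * (n * ?S)"
  proof -
    have "d x ^ 3 \<le> n * (d x)\<^sup>2" for x
      using mult_right_mono[OF abs_le_D1[OF abs_d_le[of x]], of "(d x)\<^sup>2"]
      by (simp add: power3_eq_cube power2_eq_square)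
    then show ?thesis
      unfolding sum_distrib_left[of n "\<lambda>x. (d x)\<^sup>2"] by (intro mult_left_mono sum_mono) auto
  qed
  moreover have "- (n\<^sup>2 * ?S) \<le> e * ?S"
    using mult_right_mono[OF _ S, of "- (n\<^sup>2)" e] abs_e_le by (simp add: abs_le_iff)
  moreover have "- (n\<^sup>2 * ?S) \<le> (\<Sum>x\<in>V. (d x)\<^sup>2 * d2 x)"
  proof -
    have "- (n\<^sup>2 * (d x)\<^sup>2) \<le> (d x)\<^sup>2 * d2 x" for x
      using mult_left_mono[of "- (n\<^sup>2)" "d2 x" "(d x)\<^sup>2"] abs_d2_le[of x]
      by (simp add: abs_le_iff mult.commute)
    then show ?thesis
      unfolding sum_distrib_left sum_negf[symmetric] by (intro sum_mono) auto
  qed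
  moreover have "0 \<le> (\<Sum>x\<in>V. (d2 x)\<^sup>2)"
    by (simp add: sum_nonneg)
  moreover have "0 \<le> n * e\<^sup>2"
    by simp
  moreover have "0 \<le> n\<^sup>2 * ?S"
    using S by simp
  moreover have "n * (n * ?S) = n\<^sup>2 * ?S"
    by (simp add: power2_eq_square)
  ultimately show ?thesis
    unfolding sum_five_cycle sum_banner using cycles_minus_banner_nonneg by linarith
qed

end
section \<open>Non-injective maps\<close>

lemma sum_PiE_insert:
  assumes "i \<notin> I"
  shows "(\<Sum>f\<in>insert i I \<rightarrow>\<^sub>E T. h f) = (\<Sum>y\<in>T. \<Sum>f\<in>I \<rightarrow>\<^sub>E T. h (f(i := y)))"
proof -
  have "inj_on (\<lambda>(y, f). f(i := y)) (T \<times> (I \<rightarrow>\<^sub>E T))"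
    using inj_combinator[OF assms, of "\<lambda>_. T"] .
  then show ?thesis
    by (simp add: PiE_insert_eq sum.reindex sum.cartesian_product split_def)
qed

lemma sum_PiE_five:
  fixes g :: "'b \<Rightarrow> 'b \<Rightarrow> 'b \<Rightarrow> 'b \<Rightarrow> 'b \<Rightarrow> real"
  shows "(\<Sum>f\<in>{..<5::nat} \<rightarrow>\<^sub>E T. g (f 0) (f 1) (f 2) (f 3) (f 4))
       = (\<Sum>x\<in>T. \<Sum>z\<in>T. \<Sum>b\<in>T. \<Sum>c\<in>T. \<Sum>l\<in>T. g x b z c l)"
proof -
  \<comment> \<open>Vertex 2 is inserted directly after 0 because the expansions sum first over
    \<open>x\<close> and the vertex \<open>z\<close> at distance two.\<close>
  have *: "{..<5::nat} = insert 0 (insert 2 (insert 1 (insert 3 (insert 4 {}))))"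
    by auto
  show ?thesis
    unfolding * by (simp add: sum_PiE_insert)
qed

text \<open>The probability that a uniformly random map from a \<open>k\<close>-set to an \<open>n\<close>-set is not injective.\<close>

definition collision_prob :: "nat \<Rightarrow> nat \<Rightarrow> real" where
  "collision_prob k n = 1 - real (\<Prod>i<k. n - i) / real n ^ k"

lemma collision_prob_tendsto_0: "collision_prob k \<longlonglongrightarrow> 0"
proof -
  have "(\<lambda>n. real (n - i) / real n) \<longlonglongrightarrow> 1" for i
  proof -
    have "(\<lambda>n. 1 - real i * inverse (real n)) \<longlonglongrightarrow> 1 - real i * 0"
      by (intro tendsto_intros lim_inverse_n)
    then have "(\<lambda>n. 1 - real i * inverse (real n)) \<longlonglongrightarrow> 1" by simp
    moreover have "\<forall>\<^sub>F n in sequentially. 1 - real i * inverse (real n) = real (n - i) / real n"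
      \<comment> \<open>From \<open>Suc i\<close> on the subtraction is not truncated and the
        denominator is nonzero.\<close>
      using eventually_ge_at_top[of "Suc i"]
      by eventually_elim (auto simp: of_nat_diff field_simps)
    ultimately show ?thesis by (rule Lim_transform_eventually)
  qed
  then have "(\<lambda>n. 1 - (\<Prod>i<k. real (n - i) / real n)) \<longlonglongrightarrow> 1 - (\<Prod>i<k. 1)"
    by (intro tendsto_intros)
  then show ?thesis
    by (simp add: collision_prob_def[abs_def] prod_dividef)
qed

lemma card_noninjective:
  assumes "finite I" "finite T" "T \<noteq> {}"
  shows "real (card {f \<in> I \<rightarrow>\<^sub>E T. \<not> inj_on f I})
       = collision_prob (card I) (card T) * real (card T) ^ card I"
proof -
  let ?P = "I \<rightarrow>\<^sub>E T"
  have fin: "finite ?P" using assms by (simp add: finite_PiE)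
  have "{f \<in> ?P. \<not> inj_on f I} = ?P - {f \<in> ?P. inj_on f I}" by auto
  then have "card {f \<in> ?P. \<not> inj_on f I} = card ?P - card {f \<in> ?P. inj_on f I}"
    using fin by (simp add: card_Diff_subset)
  moreover have "card {f \<in> ?P. inj_on f I} \<le> card ?P"
    using fin by (intro card_mono) auto
  moreover have "card {f \<in> ?P. inj_on f I} = (\<Prod>i<card I. card T - i)"
    using card_inj_on_subset_funcset[OF assms(1,2) order.refl]
    by (simp add: lessThan_atLeast0)
  moreover have "card ?P = card T ^ card I"
    using assms by (simp add: card_funcsetE)
  ultimately have "real (card T) ^ card I
     = real (\<Prod>i<card I. card T - i) + real (card {f \<in> ?P. \<not> inj_on f I})"
    by (simp only: of_nat_diff) simp
  moreover have "real (card T) ^ card I \<noteq> 0"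
    using assms by simp
  ultimately show ?thesis
    by (simp add: collision_prob_def field_simps)
qed

lemma card_filter_eq_sum:
  "finite S \<Longrightarrow> real (card {x \<in> S. P x}) = (\<Sum>x\<in>S. of_bool (P x))"
  by (simp add: Collect_conj_eq)

section \<open>Random graphs\<close>

lemma cycle_graph_arcs:
  "parcs (cycle_graph n) = (\<lambda>i. (i, Suc i mod n)) ` {..<n} \<union> (\<lambda>i. (Suc i mod n, i)) ` {..<n}"
  by (auto simp: cycle_graph_def)

lemma cycle_graph_5_arcs:
  "parcs (cycle_graph 5) = {(0,1),(1,2),(2,3),(3,4),(4,0),(1,0),(2,1),(3,2),(4,3),(0,4)}"
proof -
  have "{..<5::nat} = {0, 1, 2, 3, 4}" by auto
  then show ?thesis by (simp add: cycle_graph_arcs insert_commute flip: One_nat_def)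
qed

lemma banner_graph_arcs:
  "parcs banner_graph = {(0,1),(1,2),(2,3),(3,0),(0,4),(1,0),(2,1),(3,2),(0,3),(4,0)}"
proof -
  have "{..<4::nat} = {0, 1, 2, 3}" by auto
  then show ?thesis by (simp add: banner_graph_def cycle_graph_arcs insert_commute flip: One_nat_def)
qed

lemma cycle_graph_5_verts: "pverts (cycle_graph 5) = {..<5}"
  by (simp add: cycle_graph_def)

lemma banner_graph_verts: "pverts banner_graph = {..<5}"
  by (auto simp: cycle_graph_def banner_graph_def)

lemma pair_graph_sym:
  assumes "pair_graph G"
  shows "(u, v) \<in> parcs G \<longleftrightarrow> (v, u) \<in> parcs G"
proof -
  interpret pair_graph G by fact
  show ?thesis using pair_sym_arcs by (auto simp: symmetric_def dest: symD)
qed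

lemma pair_graph_irrefl:
  assumes "pair_graph G"
  shows "(u, u) \<notin> parcs G"
proof -
  interpret pair_graph G by fact
  show ?thesis using pair_no_loops[of "(u, u)"] by auto
qed

lemma pair_graph_arcs_subset:
  assumes "pair_graph G"
  shows "parcs G \<subseteq> pverts G \<times> pverts G"
proof -
  interpret pair_graph G by fact
  show ?thesis using in_arcsD1 in_arcsD2 by auto
qed

lemma pair_graphI:
  assumes "finite (pverts G)" "parcs G \<subseteq> pverts G \<times> pverts G"
    and "\<And>u. (u, u) \<notin> parcs G" "\<And>u v. (u, v) \<in> parcs G \<Longrightarrow> (v, u) \<in> parcs G"
  shows "pair_graph G"
proof unfold_locales
  show "finite (parcs G)"
    using assms(1,2) by (meson finite_SigmaI finite_subset)
  show "symmetric (with_proj G)"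
    unfolding symmetric_def with_proj_simps by (rule symI) (rule assms(4))
qed (use assms(1-3) in auto)

lemma card_graph_homs:
  assumes "finite (pverts H)" "finite (pverts G)"
  shows "real (card (graph_homs H G))
       = (\<Sum>f\<in>pverts H \<rightarrow>\<^sub>E pverts G. of_bool (\<forall>(u, v)\<in>parcs H. (f u, f v) \<in> parcs G))"
  unfolding graph_homs_def using assms by (intro card_filter_eq_sum) (simp add: finite_PiE)

section \<open>Uniformly random labelled graphs\<close>

text \<open>With \<open>E\<close> ranging over \<open>Pow (pairs V)\<close>, every labelled graph on
  \<open>V\<close> occurs exactly once, so sums over \<open>E\<close> are scaled expectations for
  the uniform random graph. Complementation becomes set difference.\<close>

definition graph_of :: "'a set \<Rightarrow> 'a set set \<Rightarrow> 'a pair_pre_digraph" where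
  "graph_of V E = \<lparr>pverts = V, parcs = {(u, v). u \<in> V \<and> v \<in> V \<and> u \<noteq> v \<and> {u, v} \<in> E}\<rparr>"

lemma pverts_graph_of [simp]: "pverts (graph_of V E) = V"
  by (simp add: graph_of_def)

lemma finite_graph_graph_of:
  "finite V \<Longrightarrow> V \<noteq> {} \<Longrightarrow> finite_graph (graph_of V E)"
  unfolding finite_graph_def
  by (intro conjI pair_graphI) (auto simp: graph_of_def insert_commute)

definition pairs :: "'a set \<Rightarrow> 'a set set" where
  "pairs V = {{u, v} | u v. u \<in> V \<and> v \<in> V \<and> u \<noteq> v}"

lemma finite_pairs: "finite V \<Longrightarrow> finite (pairs V)"
  by (rule finite_subset[of _ "Pow V"]) (auto simp: pairs_def)

lemma graph_compl_graph_of: "graph_compl (graph_of V E) = graph_of V (pairs V - E)"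
  by (auto simp: graph_compl_def graph_of_def pairs_def)

definition edges :: "'a pair_pre_digraph \<Rightarrow> 'a set set" where
  "edges H = (\<lambda>(u, v). {u, v}) ` parcs H"

lemma card_between:
  assumes "finite C" "A \<subseteq> C"
  shows "card {B. A \<subseteq> B \<and> B \<subseteq> C} = 2 ^ (card C - card A)"
proof -
  have "bij_betw (\<lambda>B. A \<union> B) (Pow (C - A)) {B. A \<subseteq> B \<and> B \<subseteq> C}"
    by (rule bij_betw_byWitness[where f' = "\<lambda>B. B - A"]) (use assms in auto)
  then have "card {B. A \<subseteq> B \<and> B \<subseteq> C} = card (Pow (C - A))"
    by (simp add: bij_betw_same_card)
  then show ?thesis
    using assms by (simp add: card_Pow card_Diff_subset finite_subset)
qed

text \<open>Exchange the sums over \<open>E\<close> and \<open>f\<close>. An injective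
  \<open>f\<close> sends the edges of \<open>H\<close> to distinct pairs, so it is a homomorphism
  for exactly the fraction \<open>1 / 2 ^ card (edges H)\<close> of all \<open>E\<close>; for the
  other maps the fraction is bounded by 1.\<close>

lemma sum_hom_density_graph_of_le:
  fixes H :: "'a pair_pre_digraph" and V :: "'b set"
  assumes H: "pair_graph H" and V: "finite V" "V \<noteq> {}"
  shows "(\<Sum>E\<in>Pow (pairs V). hom_density H (graph_of V E))
       \<le> 2 ^ card (pairs V) * (1 / 2 ^ card (edges H) + collision_prob (card (pverts H)) (card V))"
proof -
  interpret H: pair_graph H by fact
  let ?k = "card (pverts H)" and ?n = "real (card V)" and ?P = "pairs V"
  let ?F = "pverts H \<rightarrow>\<^sub>E V"
  let ?hom = "\<lambda>f E. \<forall>(u, v)\<in>parcs H. (f u, f v) \<in> parcs (graph_of V E)"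
  have finP: "finite ?P" by (rule finite_pairs[OF V(1)])
  have finF: "finite ?F" using H.pair_finite_verts V by (simp add: finite_PiE)
  have n: "?n ^ ?k > 0" using V by (simp add: card_gt_0_iff)
  have count: "(\<Sum>E\<in>Pow ?P. of_bool (?hom f E))
      \<le> (2::real) ^ card ?P * (1 / 2 ^ card (edges H) + of_bool (\<not> inj_on f (pverts H)))"
    if f: "f \<in> ?F" for f
  proof (cases "inj_on f (pverts H)")
    case True
    let ?e = "image f ` edges H"
    have sub: "\<Union> (edges H) \<subseteq> pverts H"
      using pair_graph_arcs_subset[OF H] by (auto simp: edges_def)
    have "inj_on (image f) (edges H)"
      by (rule inj_on_image) (rule inj_on_subset[OF True sub])
    then have card_e: "card ?e = card (edges H)" by (rule card_image)
    have fV: "f u \<in> V" if "u \<in> pverts H" for u using f that by auto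
    have vH: "u \<in> pverts H \<and> v \<in> pverts H \<and> u \<noteq> v" if "(u, v) \<in> parcs H" for u v
      using that pair_graph_arcs_subset[OF H] pair_graph_irrefl[OF H] by auto
    have eP: "?e \<subseteq> ?P"
    proof
      fix e assume "e \<in> ?e"
      then obtain u v where "(u, v) \<in> parcs H" "e = {f u, f v}"
        by (auto simp: edges_def)
      moreover from vH[OF this(1)] have "f u \<noteq> f v" "f u \<in> V" "f v \<in> V"
        using True fV by (auto dest: inj_onD)
      ultimately show "e \<in> ?P" by (auto simp: pairs_def)
    qed
    \<comment> \<open>The favourable edge sets form an interval in the lattice of subsets of
      \<open>?P\<close>.\<close>
    have "{E \<in> Pow ?P. ?hom f E} = {E. ?e \<subseteq> E \<and> E \<subseteq> ?P}"
    proof -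
      have "?hom f E \<longleftrightarrow> ?e \<subseteq> E" for E
      proof -
        have "(f u, f v) \<in> parcs (graph_of V E) \<longleftrightarrow> f ` {u, v} \<in> E" if "(u, v) \<in> parcs H" for u v
          using vH[OF that] True fV by (auto simp: graph_of_def dest: inj_onD)
        then have "?hom f E \<longleftrightarrow> (\<forall>(u, v)\<in>parcs H. f ` {u, v} \<in> E)" by auto
        also have "\<dots> \<longleftrightarrow> ?e \<subseteq> E" by (auto simp: edges_def simp del: image_insert)
        finally show ?thesis .
      qed
      then show ?thesis by auto
    qed
    then have "(\<Sum>E\<in>Pow ?P. of_bool (?hom f E)) = real (card {E. ?e \<subseteq> E \<and> E \<subseteq> ?P})"
      using finP card_filter_eq_sum[of "Pow ?P" "?hom f"] by simp
    also have "\<dots> = 2 ^ (card ?P - card (edges H))"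
      using card_between[OF finP eP] card_e by simp
    also have "\<dots> = 2 ^ card ?P / 2 ^ card (edges H)"
      using card_mono[OF finP eP] card_e by (simp add: power_diff)
    finally show ?thesis by (simp add: True)
  next
    case False
    have "(\<Sum>E\<in>Pow ?P. of_bool (?hom f E)) \<le> (\<Sum>E\<in>Pow ?P. (1::real))"
      by (intro sum_mono) simp
    also have "\<dots> = 2 ^ card ?P" using finP by (simp add: card_Pow)
    also have "\<dots> \<le> 2 ^ card ?P * (1 / 2 ^ card (edges H) + of_bool (\<not> inj_on f (pverts H)))"
      using False by simp
    finally show ?thesis .
  qed
  have "(\<Sum>E\<in>Pow ?P. hom_density H (graph_of V E))
      = (\<Sum>E\<in>Pow ?P. \<Sum>f\<in>?F. of_bool (?hom f E)) / ?n ^ ?k"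
    using card_graph_homs[OF H.pair_finite_verts, of "graph_of V _"] V(1)
    by (simp add: hom_density_def flip: sum_divide_distrib)
  also have "(\<Sum>E\<in>Pow ?P. \<Sum>f\<in>?F. of_bool (?hom f E)) = (\<Sum>f\<in>?F. \<Sum>E\<in>Pow ?P. of_bool (?hom f E) :: real)"
    by (rule sum.swap)
  also have "\<dots> \<le> (\<Sum>f\<in>?F. 2 ^ card ?P * (1 / 2 ^ card (edges H) + of_bool (\<not> inj_on f (pverts H))))"
    by (intro sum_mono count)
  also have "\<dots> = 2 ^ card ?P * (?n ^ ?k / 2 ^ card (edges H) + real (card {f \<in> ?F. \<not> inj_on f (pverts H)}))"
    using finF H.pair_finite_verts
    by (simp add: card_filter_eq_sum sum.distrib card_funcsetE flip: sum_distrib_left)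
  also have "\<dots> = 2 ^ card ?P * (1 / 2 ^ card (edges H) + collision_prob ?k (card V)) * ?n ^ ?k"
    using card_noninjective[OF H.pair_finite_verts V] by (simp add: algebra_simps)
  finally show ?thesis
    using n V by (simp add: divide_right_mono)
qed

lemma pair_graph_cycle_graph_5: "pair_graph (cycle_graph 5)"
  by (rule pair_graphI) (auto simp: cycle_graph_5_verts cycle_graph_5_arcs)

lemma pair_graph_banner_graph: "pair_graph banner_graph"
  by (rule pair_graphI) (auto simp: banner_graph_verts banner_graph_arcs)

lemma card_edges_cycle_graph_5: "card (edges (cycle_graph 5)) = 5"
  by (simp add: edges_def cycle_graph_5_arcs card_insert_if doubleton_eq_iff)

lemma card_edges_banner_graph: "card (edges banner_graph) = 5"
  by (simp add: edges_def banner_graph_arcs card_insert_if doubleton_eq_iff)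

text \<open>First moment argument: some graph does no worse than the average. Both patterns have
  five edges, so each density averages at most 1/32 plus the collision term, and the weights add up
  to 2.\<close>

lemma exists_graph_near_random:
  assumes "finite V" "V \<noteq> {}" and lam: "0 \<le> lam" "lam \<le> 2"
  shows "\<exists>H. finite_graph H \<and> pverts H = V \<and>
    lam * hom_density (cycle_graph 5) H + (2 - lam) * hom_density banner_graph (graph_compl H)
      \<le> 1 / 16 + 2 * collision_prob 5 (card V)"
proof (rule ccontr)
  assume none: "\<not> ?thesis"
  let ?P = "pairs V" and ?c = "collision_prob 5 (card V)"
  let ?C = "\<lambda>E. hom_density (cycle_graph 5) (graph_of V E)"
  let ?B = "\<lambda>E. hom_density banner_graph (graph_of V E)"
  have fin: "finite (Pow ?P)" using finite_pairs[OF assms(1)] by simp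
  have "(\<Sum>E\<in>Pow ?P. 1 / 16 + 2 * ?c) < (\<Sum>E\<in>Pow ?P. lam * ?C E + (2 - lam) * ?B (?P - E))"
  proof (rule sum_strict_mono[OF fin])
    fix E
    show "1 / 16 + 2 * ?c < lam * ?C E + (2 - lam) * ?B (?P - E)"
      using none finite_graph_graph_of[OF assms(1,2), of E]
      by (metis graph_compl_graph_of not_le_imp_less pverts_graph_of)
  qed auto
  also have "\<dots> = lam * (\<Sum>E\<in>Pow ?P. ?C E) + (2 - lam) * (\<Sum>E\<in>Pow ?P. ?B (?P - E))"
    by (simp add: sum.distrib sum_distrib_left)
  \<comment> \<open>Complementation is an involution, so the complement of a uniform random graph is
    again uniform.\<close>
  also have "(\<Sum>E\<in>Pow ?P. ?B (?P - E)) = (\<Sum>E\<in>Pow ?P. ?B E)"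
    by (rule sum.reindex_bij_witness[where i = "\<lambda>E. ?P - E" and j = "\<lambda>E. ?P - E"])
      (auto simp: double_diff)
  also have "lam * (\<Sum>E\<in>Pow ?P. ?C E) + (2 - lam) * (\<Sum>E\<in>Pow ?P. ?B E)
      \<le> lam * (2 ^ card ?P * (1 / 32 + ?c)) + (2 - lam) * (2 ^ card ?P * (1 / 32 + ?c))"
    using sum_hom_density_graph_of_le[OF pair_graph_cycle_graph_5 assms(1,2)]
      sum_hom_density_graph_of_le[OF pair_graph_banner_graph assms(1,2)] lam
    by (intro add_mono mult_left_mono)
      (simp_all add: card_edges_cycle_graph_5 card_edges_banner_graph
        cycle_graph_5_verts banner_graph_verts)
  also have "\<dots> = (\<Sum>E\<in>Pow ?P. 1 / 16 + 2 * ?c)"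
    using finite_pairs[OF assms(1)] by (simp add: card_Pow field_simps)
  finally show False by simp
qed

section \<open>The lower bound\<close>

lemma hom_density_five_cycle_banner_ge:
  assumes "finite_graph G"
  shows "1 / 16 - collision_prob 5 (card (pverts G))
    \<le> hom_density (cycle_graph 5) G + hom_density banner_graph (graph_compl G)"
proof -
  have G: "pair_graph G" and ne: "pverts G \<noteq> {}"
    using assms by (auto simp: finite_graph_def)
  let ?V = "pverts G" and ?n = "card (pverts G)"
  let ?F = "{..<5::nat} \<rightarrow>\<^sub>E ?V"
  \<comment> \<open>The diagonal is -1. Thus 1 + A vanishes on loops and the 5-cycle count is exact,
    whereas 1 - A equals 2 on loops that the complement lacks; this is why the banner count holds
    only up to non-injective maps.\<close>
  define A :: "'a \<Rightarrow> 'a \<Rightarrow> real" where "A x y = (if (x, y) \<in> parcs G then 1 else - 1)" for x y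
  interpret G: pair_graph G by fact
  interpret K: signed_kernel ?V A
    by unfold_locales (auto simp: A_def pair_graph_sym[OF G] G.pair_finite_verts)
  let ?hC = "\<lambda>f. \<forall>(u, v)\<in>parcs (cycle_graph 5). (f u, f v) \<in> parcs G"
  let ?hB = "\<lambda>f. \<forall>(u, v)\<in>parcs banner_graph. (f u, f v) \<in> parcs (graph_compl G)"
  have finF: "finite ?F" using G.pair_finite_verts by (simp add: finite_PiE)
  have n: "real ?n > 0" using ne G.pair_finite_verts by (simp add: card_gt_0_iff)
  have cycle: "(\<Sum>x\<in>?V. \<Sum>z\<in>?V. \<Sum>b\<in>?V. \<Sum>c\<in>?V. \<Sum>c'\<in>?V.
      (1 + A x b) * (1 + A b z) * (1 + A z c) * (1 + A c c') * (1 + A c' x))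
    = 32 * real (card (graph_homs (cycle_graph 5) G))"
  proof -
    \<comment> \<open>Every factor is 2 or 0, whence the constant 32 = 2^5.\<close>
    have "(1 + A (f 0) (f 1)) * (1 + A (f 1) (f 2)) * (1 + A (f 2) (f 3)) * (1 + A (f 3) (f 4)) * (1 + A (f 4) (f 0))
      = 32 * of_bool (?hC f)" for f :: "nat \<Rightarrow> 'a"
      using pair_graph_sym[OF G] by (auto simp: cycle_graph_5_arcs A_def)
    then show ?thesis
      using card_graph_homs[of "cycle_graph 5" G] G.pair_finite_verts
        sum_PiE_five[of "\<lambda>x b z c c'. (1 + A x b) * (1 + A b z) * (1 + A z c) * (1 + A c c') * (1 + A c' x)" ?V]
      by (simp add: cycle_graph_5_verts sum_distrib_left)
  qed
  have banner: "(\<Sum>x\<in>?V. \<Sum>z\<in>?V. \<Sum>b\<in>?V. \<Sum>b'\<in>?V. \<Sum>l\<in>?V.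
      (1 - A x b) * (1 - A b z) * (1 - A z b') * (1 - A b' x) * (1 - A x l))
    \<le> 32 * (real (card (graph_homs banner_graph (graph_compl G))) + collision_prob 5 ?n * real ?n ^ 5)"
  proof -
    let ?g = "\<lambda>f. (1 - A (f 0) (f 1)) * (1 - A (f 1) (f 2)) * (1 - A (f 2) (f 3)) * (1 - A (f 3) (f 0)) * (1 - A (f 0) (f 4))"
    have le: "?g f \<le> 32 * (of_bool (?hB f) + of_bool (\<not> inj_on f {..<5}))" if f: "f \<in> ?F" for f
    proof (cases "inj_on f {..<5}")
      case True
      have ne: "f i \<noteq> f j" if "i < 5" "j < 5" "i \<noteq> j" for i j
        using True that by (auto dest: inj_onD)
      have V: "f i \<in> ?V" if "i < 5" for i using f that by auto
      have compl: "(f i, f j) \<in> parcs (graph_compl G) \<longleftrightarrow> (f i, f j) \<notin> parcs G" if "i < 5" "j < 5" "i \<noteq> j" for i j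
        using ne[OF that] V that by (simp add: graph_compl_def)
      have "?g f = 32 * of_bool (?hB f)"
        using pair_graph_sym[OF G] by (auto simp: banner_graph_arcs compl A_def)
      then show ?thesis by simp
    next
      case False
      then show ?thesis by (auto simp: A_def)
    qed
    have "(\<Sum>f\<in>?F. ?g f) \<le> (\<Sum>f\<in>?F. 32 * (of_bool (?hB f) + of_bool (\<not> inj_on f {..<5})))"
      by (intro sum_mono le)
    also have "\<dots> = 32 * (real (card (graph_homs banner_graph (graph_compl G))) + collision_prob 5 ?n * real ?n ^ 5)"
    proof -
      have "(\<Sum>f\<in>?F. of_bool (?hB f)) = real (card (graph_homs banner_graph (graph_compl G)))"
        using card_graph_homs[of banner_graph "graph_compl G"] G.pair_finite_verts
        by (simp add: banner_graph_verts graph_compl_def)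
      moreover have "(\<Sum>f\<in>?F. of_bool (\<not> inj_on f {..<5})) = collision_prob 5 ?n * real ?n ^ 5"
        using card_noninjective[of "{..<5::nat}" ?V] G.pair_finite_verts ne
        by (simp only: card_filter_eq_sum[OF finF]) simp
      ultimately show ?thesis
        by (simp only: sum.distrib flip: sum_distrib_left)
    qed
    finally show ?thesis
      by (simp only: sum_PiE_five[of "\<lambda>x b z b' l. (1 - A x b) * (1 - A b z) * (1 - A z b') * (1 - A b' x) * (1 - A x l)" ?V])
  qed
  have "2 * real ?n ^ 5 \<le> 32 * real (card (graph_homs (cycle_graph 5) G)) +
      32 * (real (card (graph_homs banner_graph (graph_compl G))) + collision_prob 5 ?n * real ?n ^ 5)"
    using K.five_cycle_plus_banner_ge cycle banner by linarith
  then have "(1 / 16 - collision_prob 5 ?n) * real ?n ^ 5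
      \<le> real (card (graph_homs (cycle_graph 5) G)) + real (card (graph_homs banner_graph (graph_compl G)))"
    by (simp add: algebra_simps)
  then have "1 / 16 - collision_prob 5 ?n
      \<le> (real (card (graph_homs (cycle_graph 5) G)) + real (card (graph_homs banner_graph (graph_compl G))))
        / real ?n ^ 5"
    using n by (simp only: pos_le_divide_eq zero_less_power)
  moreover have "pverts (graph_compl G) = ?V" by (simp add: graph_compl_def)
  ultimately show ?thesis
    by (simp add: hom_density_def cycle_graph_5_verts banner_graph_verts add_divide_distrib)
qed

section \<open>Enumerations of graphs\<close>

text \<open>Composition with \<phi> embeds one set of homomorphisms into the other;
  \<open>restrict\<close> keeps the composites extensional. Arcs are preserved in one direction
  only, so that an isomorphism and its inverse can each be inserted.\<close>

lemma card_graph_homs_le: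
  assumes "finite (pverts K)" "parcs K \<subseteq> pverts K \<times> pverts K" "finite (pverts H)"
    and phi: "bij_betw \<phi> (pverts G) (pverts H)"
    and arcs: "\<And>u v. u \<in> pverts G \<Longrightarrow> v \<in> pverts G \<Longrightarrow> (u, v) \<in> parcs G \<Longrightarrow> (\<phi> u, \<phi> v) \<in> parcs H"
  shows "card (graph_homs K G) \<le> card (graph_homs K H)"
proof (rule card_inj_on_le)
  have inj: "inj_on \<phi> (pverts G)"
    using phi by (auto simp: bij_betw_def)
  let ?t = "\<lambda>f. restrict (\<phi> \<circ> f) (pverts K)"
  show "inj_on ?t (graph_homs K G)"
  proof (rule inj_onI)
    fix f g assume f: "f \<in> graph_homs K G" and g: "g \<in> graph_homs K G" and eq: "?t f = ?t g"
    show "f = g"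
    proof (rule PiE_ext)
      show "f \<in> pverts K \<rightarrow>\<^sub>E pverts G" "g \<in> pverts K \<rightarrow>\<^sub>E pverts G"
        using f g by (auto simp: graph_homs_def)
      fix x assume x: "x \<in> pverts K"
      have "\<phi> (f x) = \<phi> (g x)" using fun_cong[OF eq, of x] x by simp
      then show "f x = g x"
        using inj f g x by (auto simp: graph_homs_def dest: inj_onD)
    qed
  qed
  show "?t ` graph_homs K G \<subseteq> graph_homs K H"
  proof (rule image_subsetI)
    fix f assume f: "f \<in> graph_homs K G"
    then have F: "f \<in> pverts K \<rightarrow>\<^sub>E pverts G"
      and h: "\<And>u v. (u, v) \<in> parcs K \<Longrightarrow> (f u, f v) \<in> parcs G"
      by (auto simp: graph_homs_def)
    have "\<forall>(u, v)\<in>parcs K. (?t f u, ?t f v) \<in> parcs H"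
    proof clarify
      fix u v assume uv: "(u, v) \<in> parcs K"
      have "u \<in> pverts K" "v \<in> pverts K" using uv assms(2) by auto
      then show "(?t f u, ?t f v) \<in> parcs H" using arcs[OF _ _ h[OF uv]] F by auto
    qed
    moreover have "?t f \<in> pverts K \<rightarrow>\<^sub>E pverts H" using F bij_betwE[OF phi] by auto
    ultimately show "?t f \<in> graph_homs K H"
      unfolding graph_homs_def mem_Collect_eq by (intro conjI)
  qed
  show "finite (graph_homs K H)"
    unfolding graph_homs_def using assms by (intro finite_subset[OF _ finite_PiE]) auto
qed

lemma hom_density_bij:
  assumes K: "finite (pverts K)" "parcs K \<subseteq> pverts K \<times> pverts K"
    and fin: "finite (pverts G)" and phi: "bij_betw \<phi> (pverts G) (pverts H)"
    and arcs: "\<And>u v. u \<in> pverts G \<Longrightarrow> v \<in> pverts G \<Longrightarrow> (\<phi> u, \<phi> v) \<in> parcs H \<longleftrightarrow> (u, v) \<in> parcs G"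
  shows "hom_density K G = hom_density K H"
proof -
  have finH: "finite (pverts H)" using bij_betw_finite[OF phi] fin by simp
  let ?psi = "inv_into (pverts G) \<phi>"
  have "card (graph_homs K H) \<le> card (graph_homs K G)"
  proof (rule card_graph_homs_le[OF K fin bij_betw_inv_into[OF phi]])
    fix u v assume "u \<in> pverts H" "v \<in> pverts H" "(u, v) \<in> parcs H"
    then show "(?psi u, ?psi v) \<in> parcs G"
      using arcs[of "?psi u" "?psi v"] bij_betw_inv_into_right[OF phi]
        bij_betwE[OF bij_betw_inv_into[OF phi]] by simp
  qed
  moreover have "card (graph_homs K G) \<le> card (graph_homs K H)"
    by (rule card_graph_homs_le[OF K finH phi]) (simp add: arcs)
  ultimately show ?thesis
    using bij_betw_same_card[OF phi] by (simp add: hom_density_def)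
qed

text \<open>A digraph isomorphism carries a separate map on arcs. Since tails and heads in
  \<open>with_proj\<close> are the two projections, that map is determined by the map on
  vertices.\<close>

lemma digraph_iso_bij:
  assumes G: "pair_graph G" and iso: "digraph_iso (with_proj G) (with_proj H)"
  obtains \<phi> where "bij_betw \<phi> (pverts G) (pverts H)"
    and "\<And>u v. u \<in> pverts G \<Longrightarrow> v \<in> pverts G \<Longrightarrow> (\<phi> u, \<phi> v) \<in> parcs H \<longleftrightarrow> (u, v) \<in> parcs G"
proof -
  obtain f where f: "pre_digraph.digraph_isomorphism (with_proj G) f"
    and H: "with_proj H = app_iso f (with_proj G)"
    using iso by (auto simp: digraph_iso_def)
  let ?p = "iso_verts f"
  have inj: "inj_on ?p (pverts G)"
    using f by (simp add: pre_digraph.digraph_isomorphism_def)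
  have verts: "pverts H = ?p ` pverts G" and arcsH: "parcs H = iso_arcs f ` parcs G"
    and ht: "iso_tail f = fst" "iso_head f = snd"
    using H by (simp_all add: with_proj_def app_iso_def)
  have arc: "iso_arcs f (u, v) = (?p u, ?p v)" if "(u, v) \<in> parcs G" for u v
    using f that ht by (auto simp: pre_digraph.digraph_isomorphism_def prod_eq_iff)
  show thesis
  proof (rule that[of ?p])
    show "bij_betw ?p (pverts G) (pverts H)"
      using inj verts by (simp add: bij_betw_def)
    fix u v assume uv: "u \<in> pverts G" "v \<in> pverts G"
    show "(?p u, ?p v) \<in> parcs H \<longleftrightarrow> (u, v) \<in> parcs G"
    proof
      assume "(?p u, ?p v) \<in> parcs H"
      then obtain u' v' where a: "(u', v') \<in> parcs G" "(?p u, ?p v) = (?p u', ?p v')"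
        unfolding arcsH using arc by auto
      moreover have "u' \<in> pverts G" "v' \<in> pverts G"
        using a(1) pair_graph_arcs_subset[OF G] by auto
      ultimately show "(u, v) \<in> parcs G"
        using inj uv by (auto dest: inj_onD)
    next
      assume "(u, v) \<in> parcs G"
      then show "(?p u, ?p v) \<in> parcs H"
        unfolding arcsH using arc by (metis image_eqI)
    qed
  qed
qed

lemma digraph_iso_invariants:
  assumes G: "finite_graph G" and iso: "digraph_iso (with_proj G) (with_proj H)"
    and K: "pair_graph K"
  shows "card (pverts G) = card (pverts H)"
    and "hom_density K G = hom_density K H"
    and "hom_density K (graph_compl G) = hom_density K (graph_compl H)"
proof -
  have pG: "pair_graph G" using G by (simp add: finite_graph_def)
  interpret G: pair_graph G by fact
  interpret K: pair_graph K by fact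
  obtain \<phi> where phi: "bij_betw \<phi> (pverts G) (pverts H)"
    and arcs: "\<And>u v. u \<in> pverts G \<Longrightarrow> v \<in> pverts G \<Longrightarrow> (\<phi> u, \<phi> v) \<in> parcs H \<longleftrightarrow> (u, v) \<in> parcs G"
    using digraph_iso_bij[OF pG iso] by blast
  show "card (pverts G) = card (pverts H)" by (rule bij_betw_same_card[OF phi])
  show "hom_density K G = hom_density K H"
    by (rule hom_density_bij[OF K.pair_finite_verts pair_graph_arcs_subset[OF K] G.pair_finite_verts phi])
      (rule arcs)
  show "hom_density K (graph_compl G) = hom_density K (graph_compl H)"
  proof (rule hom_density_bij[OF K.pair_finite_verts pair_graph_arcs_subset[OF K]])
    fix u v assume "u \<in> pverts (graph_compl G)" "v \<in> pverts (graph_compl G)"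
    then have uv: "u \<in> pverts G" "v \<in> pverts G" by (simp_all add: graph_compl_def)
    then have "\<phi> u = \<phi> v \<longleftrightarrow> u = v" "\<phi> u \<in> pverts H" "\<phi> v \<in> pverts H"
      using phi by (auto simp: bij_betw_def dest: inj_onD)
    then show "(\<phi> u, \<phi> v) \<in> parcs (graph_compl H) \<longleftrightarrow> (u, v) \<in> parcs (graph_compl G)"
      using arcs[OF uv] uv by (simp add: graph_compl_def)
  qed (use phi G.pair_finite_verts in \<open>simp_all add: graph_compl_def\<close>)
qed

section \<open>Orders of the graphs along an enumeration\<close>

lemma finite_graph_iso_initial_segment:
  assumes "finite_graph G"
  obtains H :: "nat pair_pre_digraph" where "finite_graph H" "pverts H = {..<card (pverts G)}"
    "digraph_iso (with_proj G) (with_proj H)"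
proof -
  have G: "pair_graph G" and ne: "pverts G \<noteq> {}" using assms by (auto simp: finite_graph_def)
  interpret G: pair_graph G by fact
  obtain \<phi> where "bij_betw \<phi> (pverts G) {0..<card (pverts G)}"
    using ex_bij_betw_finite_nat[OF G.pair_finite_verts] by blast
  then have inj: "inj_on \<phi> (pverts G)" and im: "\<phi> ` pverts G = {..<card (pverts G)}"
    by (auto simp: bij_betw_def lessThan_atLeast0)
  define H where "H = \<lparr>pverts = \<phi> ` pverts G, parcs = map_prod \<phi> \<phi> ` parcs G\<rparr>"
  have sub: "parcs G \<subseteq> pverts G \<times> pverts G" by (rule pair_graph_arcs_subset[OF G])
  have "pair_graph H"
  proof (rule pair_graphI)
    show "finite (pverts H)" using G.pair_finite_verts by (simp add: H_def)
    show "parcs H \<subseteq> pverts H \<times> pverts H" using sub by (auto simp: H_def)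
    show "(u, u) \<notin> parcs H" for u
    proof
      assume "(u, u) \<in> parcs H"
      then obtain x y where xy: "(x, y) \<in> parcs G" "\<phi> x = \<phi> y" by (auto simp: H_def)
      then have "x = y" using sub inj by (auto dest: inj_onD)
      then show False using xy pair_graph_irrefl[OF G] by simp
    qed
    show "(v, u) \<in> parcs H" if uv: "(u, v) \<in> parcs H" for u v
    proof -
      obtain x y where "(x, y) \<in> parcs G" "u = \<phi> x" "v = \<phi> y" using uv by (auto simp: H_def)
      then show ?thesis using pair_graph_sym[OF G, of x y] by (force simp: H_def)
    qed
  qed
  moreover have "digraph_iso (with_proj G) (with_proj H)"
  proof -
    let ?f = "\<lparr>iso_verts = \<phi>, iso_arcs = map_prod \<phi> \<phi>, iso_head = snd, iso_tail = fst\<rparr>"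
    have "inj_on (map_prod \<phi> \<phi>) (parcs G)"
      using map_prod_inj_on[OF inj inj] sub by (rule inj_on_subset)
    then have "pre_digraph.digraph_isomorphism (with_proj G) ?f"
      using inj G.pair_wf_digraph
      by (auto simp: pre_digraph.digraph_isomorphism_def wf_digraph_wp_iff)
    moreover have "with_proj H = app_iso ?f (with_proj G)"
      by (simp add: with_proj_def app_iso_def H_def)
    ultimately show ?thesis by (auto simp: digraph_iso_def)
  qed
  ultimately show thesis
    using ne im by (intro that[of H]) (auto simp: finite_graph_def H_def)
qed

text \<open>Up to isomorphism there are finitely many graphs with fewer than \<open>Z\<close>
  vertices, since representatives can be chosen inside \<open>{..<Z}\<close>. Each class occurs at
  one index only, so choosing representatives is injective on the indices and \<open>?N\<close> is
  finite.\<close>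

lemma graph_enumeration_card_at_top:
  assumes "graph_enumeration G"
  shows "filterlim (\<lambda>n. card (pverts (G n))) at_top sequentially"
  unfolding filterlim_at_top
proof
  fix Z
  let ?N = "{n. card (pverts (G n)) < Z}"
  let ?S = "{H :: nat pair_pre_digraph. pverts H \<subseteq> {..<Z} \<and> parcs H \<subseteq> {..<Z} \<times> {..<Z}}"
  have fin: "finite_graph (G n)" for n using assms by (simp add: graph_enumeration_def)
  have "\<forall>n\<in>?N. \<exists>H. H \<in> ?S \<and> finite_graph H \<and> digraph_iso (with_proj (G n)) (with_proj H)"
  proof
    fix n assume n: "n \<in> ?N"
    obtain H :: "nat pair_pre_digraph" where H: "finite_graph H" "pverts H = {..<card (pverts (G n))}"
      "digraph_iso (with_proj (G n)) (with_proj H)"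
      using finite_graph_iso_initial_segment[OF fin] by blast
    then have "parcs H \<subseteq> pverts H \<times> pverts H"
      by (intro pair_graph_arcs_subset) (simp add: finite_graph_def)
    then show "\<exists>H. H \<in> ?S \<and> finite_graph H \<and> digraph_iso (with_proj (G n)) (with_proj H)"
      using H n by (intro exI[of _ H]) auto
  qed
  from bchoice[OF this] obtain h where h: "\<And>n. n \<in> ?N \<Longrightarrow> h n \<in> ?S"
      "\<And>n. n \<in> ?N \<Longrightarrow> finite_graph (h n)"
      "\<And>n. n \<in> ?N \<Longrightarrow> digraph_iso (with_proj (G n)) (with_proj (h n))"
    by blast
  have "inj_on h ?N"
  proof (rule inj_onI)
    fix m n assume mn: "m \<in> ?N" "n \<in> ?N" "h m = h n"
    have "\<exists>!k. digraph_iso (with_proj (G k)) (with_proj (h m))"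
      using assms h(2)[OF mn(1)] by (simp add: graph_enumeration_def)
    then show "m = n" using h(3)[OF mn(1)] h(3)[OF mn(2)] unfolding mn(3) by blast
  qed
  moreover have "finite ?S"
  proof (rule finite_subset)
    show "?S \<subseteq> (\<lambda>(A, B). \<lparr>pverts = A, parcs = B\<rparr>) ` (Pow {..<Z} \<times> Pow ({..<Z} \<times> {..<Z}))"
    proof
      fix H assume "H \<in> ?S"
      moreover have "H = (\<lambda>(A, B). \<lparr>pverts = A, parcs = B\<rparr>) (pverts H, parcs H)" by simp
      ultimately show "H \<in> (\<lambda>(A, B). \<lparr>pverts = A, parcs = B\<rparr>) ` (Pow {..<Z} \<times> Pow ({..<Z} \<times> {..<Z}))"
        by blast
    qed
  qed simp
  ultimately have "finite ?N"
    using h(1) by (blast intro: inj_on_finite[of h ?N ?S])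
  then have "\<forall>\<^sub>F n in cofinite. \<not> card (pverts (G n)) < Z"
    unfolding eventually_cofinite by simp
  then show "\<forall>\<^sub>F n in sequentially. Z \<le> card (pverts (G n))"
    unfolding cofinite_eq_sequentially by eventually_elim simp
qed

section \<open>Upper and lower bounds for the limit inferior\<close>

text \<open>If the limit inferior exceeded 1/16, all late graphs would have values above some
  \<open>y > 1 / 16\<close>. A near-random graph of large order has a smaller value, and its
  isomorphic copy in the sequence can be forced to occur late.\<close>

lemma c_lambda_five_cycle_banner_le:
  fixes G :: "nat \<Rightarrow> nat pair_pre_digraph"
  assumes G: "graph_enumeration G" and lam: "0 \<le> lam" "lam \<le> 2"
  shows "c_lambda G lam (cycle_graph 5) banner_graph \<le> ereal (1 / 16)"
proof (rule ccontr)
  define t where "t H = lam * hom_density (cycle_graph 5) H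
    + (2 - lam) * hom_density banner_graph (graph_compl H)" for H :: "nat pair_pre_digraph"
  assume "\<not> ?thesis"
  then have "ereal (1 / 16) < liminf (\<lambda>n. ereal (t (G n)))"
    by (simp add: c_lambda_def t_def)
  then obtain y where y: "1 / 16 < y" "ereal y < liminf (\<lambda>n. ereal (t (G n)))"
    using ereal_dense2 by (metis less_ereal.simps(1))
  then obtain n0 where n0: "\<And>n. n \<ge> n0 \<Longrightarrow> y < t (G n)"
    using less_LiminfD[OF y(2)] by (auto simp: eventually_sequentially)
  \<comment> \<open>Half the gap, since the collision term enters twice.\<close>
  have "\<forall>\<^sub>F N in sequentially. collision_prob 5 N < (y - 1 / 16) / 2"
    using collision_prob_tendsto_0 y(1) by (intro order_tendstoD) auto
  then obtain N0 where N0: "\<And>N. N \<ge> N0 \<Longrightarrow> collision_prob 5 N < (y - 1 / 16) / 2"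
    by (auto simp: eventually_sequentially)
  \<comment> \<open>Larger than \<open>N0\<close>, to make the collision term small, and larger than
    the order of each of the first \<open>n0\<close> graphs, so that a copy of a graph on
    \<open>N\<close> vertices has index at least \<open>n0\<close>.\<close>
  define N where "N = Suc (N0 + (\<Sum>n<n0. card (pverts (G n))))"
  obtain H :: "nat pair_pre_digraph" where H: "finite_graph H" "pverts H = {..<N}"
      "t H \<le> 1 / 16 + 2 * collision_prob 5 N"
    using exists_graph_near_random[of "{..<N}" lam] lam by (auto simp: t_def N_def lessThan_empty_iff)
  obtain n where n: "digraph_iso (with_proj (G n)) (with_proj H)"
    using G H(1) unfolding graph_enumeration_def by blast
  have fin: "finite_graph (G n)" using G by (simp add: graph_enumeration_def)
  note inv = digraph_iso_invariants[OF fin n]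
  have "card (pverts (G n)) = N"
    using inv(1)[OF pair_graph_banner_graph] H(2) by simp
  moreover have "card (pverts (G n)) < N" if "n < n0"
    using member_le_sum[of n "{..<n0}" "\<lambda>n. card (pverts (G n))"] that by (simp add: N_def)
  ultimately have "n \<ge> n0" by (meson less_irrefl not_le)
  then have "y < t (G n)" by (rule n0)
  also have "t (G n) = t H"
    by (simp add: t_def inv(2)[OF pair_graph_cycle_graph_5] inv(3)[OF pair_graph_banner_graph])
  also have "\<dots> < y" using H(3) N0[of N] by (simp add: N_def)
  finally show False .
qed

text \<open>At \<open>lam = 1\<close> both weights are 1, so the bound for single graphs applies
  termwise; its error vanishes because the orders tend to infinity.\<close>

lemma c_lambda_1_five_cycle_banner_ge:
  fixes G :: "nat \<Rightarrow> nat pair_pre_digraph"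
  assumes G: "graph_enumeration G"
  shows "ereal (1 / 16) \<le> c_lambda G 1 (cycle_graph 5) banner_graph"
proof -
  have "(\<lambda>n. 1 / 16 - collision_prob 5 (card (pverts (G n)))) \<longlonglongrightarrow> 1 / 16 - 0"
    by (intro tendsto_intros filterlim_compose[OF collision_prob_tendsto_0]
        graph_enumeration_card_at_top G)
  then have "(\<lambda>n. ereal (1 / 16 - collision_prob 5 (card (pverts (G n))))) \<longlonglongrightarrow> ereal (1 / 16)"
    by simp
  then have "ereal (1 / 16) = liminf (\<lambda>n. ereal (1 / 16 - collision_prob 5 (card (pverts (G n)))))"
    by (intro lim_imp_Liminf[symmetric]) auto
  also have "\<dots> \<le> c_lambda G 1 (cycle_graph 5) banner_graph"
    unfolding c_lambda_def
    using G by (intro Liminf_mono always_eventually)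
      (auto simp: graph_enumeration_def intro: hom_density_five_cycle_banner_ge)
  finally show ?thesis .
qed

theorem theorem1p9:
  fixes G :: "nat \<Rightarrow> nat pair_pre_digraph"
  assumes "graph_enumeration G"
  shows "c_max G (cycle_graph 5) banner_graph = c_lambda G 1 (cycle_graph 5) banner_graph
       \<and> c_lambda G 1 (cycle_graph 5) banner_graph = ereal (1 / 16)"
proof -
  have one: "c_lambda G 1 (cycle_graph 5) banner_graph = ereal (1 / 16)"
    using c_lambda_five_cycle_banner_le[OF assms, of 1] c_lambda_1_five_cycle_banner_ge[OF assms]
    by (simp add: antisym)
  \<comment> \<open>The upper bound is uniform in \<open>lam\<close>, so the supremum is attained at
    \<open>lam = 1\<close>.\<close>
  have "c_max G (cycle_graph 5) banner_graph = ereal (1 / 16)"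
    unfolding c_max_def
  proof (rule antisym)
    show "(SUP lam\<in>{0..2}. c_lambda G lam (cycle_graph 5) banner_graph) \<le> ereal (1 / 16)"
      by (intro SUP_least c_lambda_five_cycle_banner_le[OF assms]) auto
    show "ereal (1 / 16) \<le> (SUP lam\<in>{0..2}. c_lambda G lam (cycle_graph 5) banner_graph)"
      unfolding one[symmetric] by (intro SUP_upper) auto
  qed
  with one show ?thesis by simp
qed

end
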